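(* Let $M$ be an ordered $\Gamma$-groupoid and let $\mu : M \to [0,1]$ be a fuzzy subset of $M$. (i) If $\mu$ is a fuzzy prime ideal of $M$ and $t\in[0,1]$ is such that $\mu_t \neq \emptyset$, then $\mu_t$ is a prime ideal of $M$. (ii) Conversely, if $\mu_t$ is a prime ideal of $M$ for every $t\in[0,1]$, then $\mu$ is a fuzzy prime ideal of $M$.
   Context: Let $M,\Gamma$ be nonempty sets. $M$ is a $\Gamma$-groupoid if there is a well-defined operation $M\times\Gamma\times M\to M$, $(a,\gamma,b)\mapsto a\gamma b$ (no associativity assumed). An ordered $\Gamma$-groupoid is a $\Gamma$-groupoid $M$ with a partial order $\le$ on $M$ such that $a\le b$ implies $a\gamma c\le b\gamma c$ and $c\gamma a\le c\gamma b$ for all $c\in M$, $\gamma\in\Gamma$. A nonempty subset $A\subseteq M$ is a left (resp. right) ideal of $M$ if (1) $x\gamma a\in A$ (resp. $a\gamma x\in A$) for all $x\in M,\gamma\in\Gamma,a\in A$, and (2) $a\in A$, $b\in M$, $b\le a$ imply $b\in A$. It is an ideal if it is both a left and a right ideal. (In particular ideals are nonempty by definition.) A subset $T\subseteq M$ is prime if for all $a,b\in M$, $\gamma\in\Gamma$, $a\gamma b\in T$ implies $a\in T$ or $b\in T$. A prime ideal is an ideal which is a prime subset. A fuzzy subset of $M$ is any mapping $\mu:M\to[0,1]$. It is a fuzzy left (resp. right) ideal of $M$ if (1) $\mu(x\gamma y)\ge\mu(y)$ (resp. $\mu(x\gamma y)\ge\mu(x)$) for all $x,y\in M$, $\gamma\in\Gamma$,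 and (2) $x\le y$ implies $\mu(x)\ge\mu(y)$. It is a fuzzy ideal if it is both a fuzzy left and a fuzzy right ideal. It is a fuzzy prime subset if $\mu(x\gamma y)\le\max\{\mu(x),\mu(y)\}$ for all $x,y\in M$, $\gamma\in\Gamma$. A fuzzy prime ideal is a fuzzy ideal which is a fuzzy prime subset. For $t\in[0,1]$, the level subset is $\mu_t:=\{x\in M\mid \mu(x)\ge t\}$. *)

theory Defs
  imports Complex_Main "HOL-Library.FuncSet"
begin

locale gamma_groupoid =
  fixes M :: "'a set" and G :: "'g set" and f :: "'a \<Rightarrow> 'g \<Rightarrow> 'a \<Rightarrow> 'a"
  assumes M_nonempty: "M \<noteq> {}"
    and G_nonempty: "G \<noteq> {}"
    and op_closed: "\<lbrakk>a \<in> M; g \<in> G; b \<in> M\<rbrakk> \<Longrightarrow> f a g b \<in> M"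

text \<open>The order is a relation \<open>r\<close>; \<open>(a, b) \<in> r\<close> stands for \<open>a \<le> b\<close>.\<close>

locale ordered_gamma_groupoid = gamma_groupoid M G f
  for M :: "'a set" and G :: "'g set" and f :: "'a \<Rightarrow> 'g \<Rightarrow> 'a \<Rightarrow> 'a" +
  fixes r :: "'a rel"
  assumes order: "partial_order_on M r"
    and op_mono_left: "\<lbrakk>(a, b) \<in> r; c \<in> M; g \<in> G\<rbrakk> \<Longrightarrow> (f a g c, f b g c) \<in> r"
    and op_mono_right: "\<lbrakk>(a, b) \<in> r; c \<in> M; g \<in> G\<rbrakk> \<Longrightarrow> (f c g a, f c g b) \<in> r"
begin

definition left_ideal :: "'a set \<Rightarrow> bool" where
  "left_ideal A \<longleftrightarrow> A \<noteq> {} \<and> A \<subseteq> M \<and>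
     (\<forall>x\<in>M. \<forall>g\<in>G. \<forall>a\<in>A. f x g a \<in> A) \<and>
     (\<forall>a\<in>A. \<forall>b\<in>M. (b, a) \<in> r \<longrightarrow> b \<in> A)"

definition right_ideal :: "'a set \<Rightarrow> bool" where
  "right_ideal A \<longleftrightarrow> A \<noteq> {} \<and> A \<subseteq> M \<and>
     (\<forall>x\<in>M. \<forall>g\<in>G. \<forall>a\<in>A. f a g x \<in> A) \<and>
     (\<forall>a\<in>A. \<forall>b\<in>M. (b, a) \<in> r \<longrightarrow> b \<in> A)"

definition ideal :: "'a set \<Rightarrow> bool" where
  "ideal A \<longleftrightarrow> left_ideal A \<and> right_ideal A"

definition prime_subset :: "'a set \<Rightarrow> bool" where
  "prime_subset T \<longleftrightarrow> T \<subseteq> M \<and>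
     (\<forall>a\<in>M. \<forall>b\<in>M. \<forall>g\<in>G. f a g b \<in> T \<longrightarrow> a \<in> T \<or> b \<in> T)"

definition prime_ideal :: "'a set \<Rightarrow> bool" where
  "prime_ideal A \<longleftrightarrow> ideal A \<and> prime_subset A"

text \<open>Only the values of \<open>\<mu>\<close> on \<open>M\<close> matter; outside \<open>M\<close> the function is unconstrained.\<close>

definition fuzzy_subset :: "('a \<Rightarrow> real) \<Rightarrow> bool" where
  "fuzzy_subset \<mu> \<longleftrightarrow> \<mu> \<in> M \<rightarrow> {0..1}"

definition fuzzy_left_ideal :: "('a \<Rightarrow> real) \<Rightarrow> bool" where
  "fuzzy_left_ideal \<mu> \<longleftrightarrow> fuzzy_subset \<mu> \<and>
     (\<forall>x\<in>M. \<forall>y\<in>M. \<forall>g\<in>G. \<mu> (f x g y) \<ge> \<mu> y) \<and>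
     (\<forall>x\<in>M. \<forall>y\<in>M. (x, y) \<in> r \<longrightarrow> \<mu> x \<ge> \<mu> y)"

definition fuzzy_right_ideal :: "('a \<Rightarrow> real) \<Rightarrow> bool" where
  "fuzzy_right_ideal \<mu> \<longleftrightarrow> fuzzy_subset \<mu> \<and>
     (\<forall>x\<in>M. \<forall>y\<in>M. \<forall>g\<in>G. \<mu> (f x g y) \<ge> \<mu> x) \<and>
     (\<forall>x\<in>M. \<forall>y\<in>M. (x, y) \<in> r \<longrightarrow> \<mu> x \<ge> \<mu> y)"

definition fuzzy_ideal :: "('a \<Rightarrow> real) \<Rightarrow> bool" where
  "fuzzy_ideal \<mu> \<longleftrightarrow> fuzzy_left_ideal \<mu> \<and> fuzzy_right_ideal \<mu>"

definition fuzzy_prime_subset :: "('a \<Rightarrow> real) \<Rightarrow> bool" where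
  "fuzzy_prime_subset \<mu> \<longleftrightarrow> fuzzy_subset \<mu> \<and>
     (\<forall>x\<in>M. \<forall>y\<in>M. \<forall>g\<in>G. \<mu> (f x g y) \<le> max (\<mu> x) (\<mu> y))"

definition fuzzy_prime_ideal :: "('a \<Rightarrow> real) \<Rightarrow> bool" where
  "fuzzy_prime_ideal \<mu> \<longleftrightarrow> fuzzy_ideal \<mu> \<and> fuzzy_prime_subset \<mu>"

definition level_subset :: "('a \<Rightarrow> real) \<Rightarrow> real \<Rightarrow> 'a set" where
  "level_subset \<mu> t = {x \<in> M. \<mu> x \<ge> t}"

end

end

theory Submission
  imports Defs
begin

text \<open>For reals, u \<le> v holds iff every threshold t \<le> u also satisfies t \<le> v, and t
  \<le> max u v iff t \<le> u or t \<le> v. So each fuzzy inequality says the same as the matching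
  closure property of the level subsets: bounds from below on products give absorption, antitonicity
  gives downward closure, and the bound by the maximum gives primeness.
  \<open>prime_ideal_level_subset\<close> chains the inequalities with one threshold t;
  \<open>fuzzy_prime_ideal_if_level_subsets\<close> recovers them by taking values of
  \<open>\<mu>\<close> itself as thresholds.\<close>

lemma (in ordered_gamma_groupoid) prime_ideal_level_subset:
  assumes "fuzzy_prime_ideal \<mu>" and "level_subset \<mu> t \<noteq> {}"
  shows "prime_ideal (level_subset \<mu> t)"
proof -
  have left: "\<mu> y \<le> \<mu> (f x g y)" and right: "\<mu> x \<le> \<mu> (f x g y)"
    and prime: "\<mu> (f x g y) \<le> max (\<mu> x) (\<mu> y)"
    if "x \<in> M" "y \<in> M" "g \<in> G" for x y g
    using assms(1) that
    by (simp_all add: fuzzy_prime_ideal_def fuzzy_ideal_def fuzzy_left_ideal_def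
        fuzzy_right_ideal_def fuzzy_prime_subset_def)
  have anti: "\<mu> y \<le> \<mu> x" if "x \<in> M" "y \<in> M" "(x, y) \<in> r" for x y
    using assms(1) that
    by (simp add: fuzzy_prime_ideal_def fuzzy_ideal_def fuzzy_left_ideal_def)
  have down: "b \<in> level_subset \<mu> t"
    if "a \<in> level_subset \<mu> t" "b \<in> M" "(b, a) \<in> r" for a b
    using that anti[of b a] by (simp add: level_subset_def)
  have "f x g a \<in> level_subset \<mu> t" "f a g x \<in> level_subset \<mu> t"
    if "x \<in> M" "g \<in> G" "a \<in> level_subset \<mu> t" for x g a
    using that left[of x a g] right[of a x g] by (simp_all add: level_subset_def op_closed)
  moreover have "a \<in> level_subset \<mu> t \<or> b \<in> level_subset \<mu> t"
    if "a \<in> M" "b \<in> M" "g \<in> G" "f a g b \<in> level_subset \<mu> t" for a b g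
    using that prime[of a b g] by (auto simp: level_subset_def le_max_iff_disj)
  moreover have "level_subset \<mu> t \<subseteq> M"
    by (simp add: level_subset_def)
  ultimately show ?thesis
    using assms(2) down
    by (simp add: prime_ideal_def ideal_def left_ideal_def right_ideal_def prime_subset_def)
qed

text \<open>Each inequality between values of \<open>\<mu>\<close> is read off the level subset at the value
  that should be the smaller one.\<close>

lemma (in ordered_gamma_groupoid) fuzzy_prime_ideal_if_level_subsets:
  assumes \<mu>: "fuzzy_subset \<mu>"
    and level: "\<And>t. t \<in> {0..1} \<Longrightarrow> prime_ideal (level_subset \<mu> t)"
  shows "fuzzy_prime_ideal \<mu>"
proof -
  \<comment> \<open>The threshold is \<open>\<mu> x\<close>, which lies in [0,1] because
    \<open>\<mu>\<close> is a fuzzy subset. The point \<open>x\<close> belongs to its own level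
    subset, so the ideal properties can be applied to it.\<close>
  have L: "prime_ideal {z \<in> M. \<mu> x \<le> \<mu> z}" if "x \<in> M" for x
    using level[of "\<mu> x"] \<mu> that by (simp add: fuzzy_subset_def level_subset_def Pi_iff)
  have left: "\<mu> y \<le> \<mu> (f x g y)" and right: "\<mu> x \<le> \<mu> (f x g y)"
    if "x \<in> M" "y \<in> M" "g \<in> G" for x y g
    using L[of y] L[of x] that
    by (simp_all add: prime_ideal_def ideal_def left_ideal_def right_ideal_def)
  have anti: "\<mu> y \<le> \<mu> x" if "x \<in> M" "y \<in> M" "(x, y) \<in> r" for x y
    using L[of y] that by (auto simp: prime_ideal_def ideal_def left_ideal_def)
  have prime: "\<mu> (f x g y) \<le> max (\<mu> x) (\<mu> y)"
    if "x \<in> M" "y \<in> M" "g \<in> G" for x y g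
    \<comment> \<open>The threshold is the value at the product, which lies in \<open>M\<close> by
      closure and hence in its own level subset. Primeness then puts \<open>x\<close> or
      \<open>y\<close> there, so one of \<open>\<mu> x\<close>, \<open>\<mu> y\<close> is at least
      that value.\<close>
    using L[of "f x g y"] op_closed[of x g y] that
    by (auto simp: prime_ideal_def prime_subset_def le_max_iff_disj)
  show ?thesis
    using \<mu> left right anti prime
    by (simp add: fuzzy_prime_ideal_def fuzzy_ideal_def fuzzy_left_ideal_def
        fuzzy_right_ideal_def fuzzy_prime_subset_def)
qed

theorem theorem8:
  fixes M :: "'a set" and G :: "'g set" and f :: "'a \<Rightarrow> 'g \<Rightarrow> 'a \<Rightarrow> 'a"
    and r :: "'a rel" and \<mu> :: "'a \<Rightarrow> real"
  assumes "ordered_gamma_groupoid M G f r"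
    and "ordered_gamma_groupoid.fuzzy_subset M \<mu>"
  shows "(ordered_gamma_groupoid.fuzzy_prime_ideal M G f r \<mu> \<longrightarrow>
            (\<forall>t\<in>{0..1}. ordered_gamma_groupoid.level_subset M \<mu> t \<noteq> {} \<longrightarrow>
               ordered_gamma_groupoid.prime_ideal M G f r
                 (ordered_gamma_groupoid.level_subset M \<mu> t)))
       \<and> ((\<forall>t\<in>{0..1}. ordered_gamma_groupoid.prime_ideal M G f r
                 (ordered_gamma_groupoid.level_subset M \<mu> t)) \<longrightarrow>
            ordered_gamma_groupoid.fuzzy_prime_ideal M G f r \<mu>)"
proof -
  interpret ordered_gamma_groupoid M G f r by fact
  show ?thesis
    using prime_ideal_level_subset fuzzy_prime_ideal_if_level_subsets assms(2) by blast
qed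

end
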